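(* There exists a constant $C_0>0$ such that for every analytic map $\phi\colon\mathbb{D}\to\mathbb{D}$, $$\mathcal{A}\big(\{z\in\mathbb{D}:\phi(z)\in S(\xi,\varepsilon h)\}\big)\le C_0\,\varepsilon^2\,\mathcal{A}\big(\{z\in\mathbb{D}:\phi(z)\in S(\xi,h)\}\big)$$ for every $\xi\in\mathbb{T}$, every $0<h<1-|\phi(0)|$ and every $0<\varepsilon\le1$.
   Context: $\mathbb{D}$ is the open unit disk, $\mathbb{T}$ the unit circle, $\mathcal{A}$ the normalized area measure $dx\,dy/\pi$ on $\mathbb{D}$. For $\xi\in\mathbb{T}$ and $h>0$, $S(\xi,h)=\{z\in\mathbb{D}:|z-\xi|<h\}$. *)

theory Defs
  imports "HOL-Complex_Analysis.Complex_Analysis"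
begin

definition unit_disc :: "complex set" where
  "unit_disc = ball 0 1"

definition nArea :: "complex set \<Rightarrow> real" where
  "nArea S = measure lebesgue S / pi"

definition carleson_window :: "complex \<Rightarrow> real \<Rightarrow> complex set" where
  "carleson_window \<xi> h = {z \<in> unit_disc. cmod (z - \<xi>) < h}"

end

theory Submission
  imports Defs
begin

text \<open>With \<open>f = h / (1 - cnj \<xi> * \<phi>)\<close>, a function with positive real part and \<open>cmod (f 0) \<le> 1\<close>,
the window of size \<open>\<epsilon> h\<close> becomes the superlevel set \<open>cmod f > c\<close> for \<open>c = 1 / \<epsilon>\<close>, and one has to gain
\<open>c\<^sup>-\<^sup>2\<close> against the superlevel set \<open>cmod f > 1\<close>. One factor \<open>1 / c\<close> is Kolmogorov's weak type
estimate on circles, obtained from the mean value of \<open>Re (f / (f + c))\<close>; the other holds because \<open>cmod (f z) > c\<close> forces \<open>z\<close> into an annulus of width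
\<open>O(cmod (f 0) / c)\<close>. A Moebius map transports this bound to the part of the disc near a point \<open>a\<close>, at
scale \<open>1 - cmod a\<close>. Every radius ending in a point with \<open>cmod f > c\<close> contains a point \<open>a\<close> where
\<open>cmod (f a) = 4\<close>, and \<open>cmod f > 1\<close> on a disc about \<open>a\<close> of radius comparable to \<open>1 - cmod a\<close>, so Vitali's
covering lemma sums up the local estimates. Constants do not matter, so changes of variables
(rotations when averaging over circles, Moebius maps) are handled by a Lipschitz bound only.\<close>

section \<open>Vitali packing and Lipschitz images\<close>

text \<open>Subadditivity over the \<open>B i\<close>, the local inequality and additivity over the
  disjoint \<open>D i\<close> inside \<open>U\<close> bound every finite subunion by the same
  number, and such a bound passes to the countable union. Each application of Vitali's lemma below
  ends with this summation.\<close>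

lemma measure_le_disjoint_packing:
  fixes B D :: "'i \<Rightarrow> 'a::euclidean_space set"
  assumes C: "countable C" and S: "S \<in> sets lebesgue" "S \<subseteq> (\<Union>i\<in>C. B i)"
    and B: "\<And>i. i \<in> C \<Longrightarrow> B i \<in> lmeasurable"
    and D: "\<And>i. i \<in> C \<Longrightarrow> D i \<in> lmeasurable" "\<And>i. i \<in> C \<Longrightarrow> D i \<subseteq> U"
    and disj: "pairwise (\<lambda>i j. disjnt (D i) (D j)) C" and U: "U \<in> lmeasurable" and "0 \<le> c"
    and le: "\<And>i. i \<in> C \<Longrightarrow> measure lebesgue (B i) \<le> c * measure lebesgue (D i)"
  shows "measure lebesgue S \<le> c * measure lebesgue U"
proof -
  have fin: "measure lebesgue (\<Union>i\<in>F. B i) \<le> c * measure lebesgue U"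
    if F: "F \<subseteq> C" "finite F" for F
  proof -
    have "measure lebesgue (\<Union>i\<in>F. B i) \<le> (\<Sum>i\<in>F. measure lebesgue (B i))"
      using F B by (intro measure_UNION_le) (auto dest: fmeasurableD)
    also have "\<dots> \<le> (\<Sum>i\<in>F. c * measure lebesgue (D i))"
      using F le by (intro sum_mono) auto
    also have "\<dots> = c * measure lebesgue (\<Union>i\<in>F. D i)"
    proof -
      have "measure lebesgue (\<Union>i\<in>F. D i) = (\<Sum>i\<in>F. measure lebesgue (D i))"
        using F D pairwise_subset[OF disj] by (intro measure_UNION') auto
      then show ?thesis by (simp add: sum_distrib_left)
    qed
    also have "\<dots> \<le> c * measure lebesgue U"
      using F D U \<open>0 \<le> c\<close>
      by (intro mult_left_mono measure_mono_fmeasurable sets.finite_UN) (auto dest: fmeasurableD)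
    finally show ?thesis .
  qed
  have "(\<Union>i\<in>C. B i) \<in> lmeasurable"
    using C B fin by (rule fmeasurable_UN_bound)
  then have "measure lebesgue S \<le> measure lebesgue (\<Union>i\<in>C. B i)"
    using S by (intro measure_mono_fmeasurable) auto
  also have "\<dots> \<le> c * measure lebesgue U"
    using C B fin by (rule measure_UN_bound)
  finally show ?thesis .
qed

text \<open>Vitali's lemma selects disjoint balls of radius \<open>r x\<close> inside
  \<open>S\<close> whose fivefold enlargements cover \<open>S\<close>; \<open>f\<close> maps the
  part of \<open>S\<close> in an enlarged ball into a ball of radius \<open>5 * L * r x\<close>,
  whence the factor. Working with a measurable \<open>T\<close> inside the image avoids discussing
  the measurability of the image itself.\<close>

lemma measure_lipschitz_image_le:
  fixes f :: "'a::euclidean_space \<Rightarrow> 'a"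
  assumes S: "open S" "S \<in> lmeasurable" and T: "T \<in> sets lebesgue" "T \<subseteq> f ` S"
    and L: "0 \<le> L" "\<And>x y. x \<in> S \<Longrightarrow> y \<in> S \<Longrightarrow> dist (f x) (f y) \<le> L * dist x y"
  shows "measure lebesgue T \<le> (5 * L) ^ DIM('a) * measure lebesgue S"
proof -
  have "\<forall>x\<in>S. \<exists>r. 0 < r \<and> r \<le> 1 \<and> cball x r \<subseteq> S"
  proof
    fix x assume "x \<in> S"
    from open_contains_cball[THEN iffD1, OF S(1), THEN bspec, OF this]
    obtain e where e: "e > 0" "cball x e \<subseteq> S"
      by (elim exE conjE)
    then show "\<exists>r. 0 < r \<and> r \<le> 1 \<and> cball x r \<subseteq> S"
      by (intro exI[of _ "min e 1"] conjI order_trans[OF subset_cball e(2)]) auto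
  qed
  then obtain r where r: "\<And>x. x \<in> S \<Longrightarrow> 0 < r x \<and> r x \<le> 1" "\<And>x. x \<in> S \<Longrightarrow> cball x (r x) \<subseteq> S"
    unfolding bchoice_iff by blast
  have "S \<subseteq> (\<Union>x\<in>S. cball x (r x))"
    using r(1) by force
  then obtain C where C: "countable C" "C \<subseteq> S"
      "pairwise (\<lambda>x y. disjnt (cball x (r x)) (cball y (r y))) C"
      "S \<subseteq> (\<Union>x\<in>C. cball x (5 * r x))"
    using Vitali_covering_lemma_cballs[of S "\<lambda>x. x" r S 1] r(1) by auto
  show ?thesis
  proof (rule measure_le_disjoint_packing[OF C(1) T(1) _ _ _ _ C(3) S(2)])
    show "T \<subseteq> (\<Union>x\<in>C. cball (f x) (L * (5 * r x)))"
    proof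
      fix y assume "y \<in> T"
      then obtain x where x: "x \<in> S" "y = f x"
        using T by blast
      then obtain c where c: "c \<in> C" "dist c x \<le> 5 * r c"
        using C(4) by (auto simp: subset_iff)
      then have "dist (f c) (f x) \<le> L * (5 * r c)"
        using L(2)[of c x] x C(2) mult_left_mono[OF c(2) L(1)] by auto
      then show "y \<in> (\<Union>x\<in>C. cball (f x) (L * (5 * r x)))"
        using c x by auto
    qed
    fix x assume "x \<in> C"
    then have "0 < r x" "cball x (r x) \<subseteq> S"
      using C(2) r by auto
    then show "measure lebesgue (cball (f x) (L * (5 * r x)))
        \<le> (5 * L) ^ DIM('a) * measure lebesgue (cball x (r x))"
      using L(1) by (simp add: content_cball power_mult_distrib mult_ac)
    show "cball x (r x) \<subseteq> S" by fact
  qed (use L(1) in auto)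
qed

section \<open>Functions with positive real part: Schwarz-Pick and circle means\<close>

text \<open>The Cayley transform sending \<open>p\<close> to
  \<open>(p - g a) / (p + cnj (g a))\<close> takes the right half-plane into the unit disc and
  \<open>g a\<close> to \<open>0\<close>, so Schwarz's lemma applies to \<open>u\<close>. With the
  denominator cleared, the estimate bounds \<open>cmod (g z)\<close> in terms of
  \<open>cmod (g a)\<close> from above and from below; both directions are used.\<close>

lemma Re_pos_Schwarz_Pick:
  assumes g: "g holomorphic_on ball a r" "\<And>z. z \<in> ball a r \<Longrightarrow> 0 < Re (g z)"
    and z: "z \<in> ball a r"
  shows "r * cmod (g z - g a) \<le> dist a z * (cmod (g z) + cmod (g a))"
proof -
  have r: "0 < r" using z by (metis ball_eq_empty empty_iff not_le)
  define u where "u = (\<lambda>w::complex. (g (a + r * w) - g a) / (g (a + r * w) + cnj (g a)))"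
  have ball: "a + r * w \<in> ball a r" if "w \<in> ball 0 1" for w :: complex
    using that r by (simp add: dist_norm norm_mult)
  have pos: "0 < Re (g a)" using g(2) r by simp
  have nz: "g (a + r * w) + cnj (g a) \<noteq> 0" if "w \<in> ball 0 1" for w :: complex
    using g(2)[OF ball[OF that]] pos by (auto simp: complex_eq_iff)
  have lt: "cmod (u w) < 1" if w: "w \<in> ball 0 1" for w
  proof -
    define p q where "p = g (a + r * w)" and "q = g a"
    have "0 < Re p" "0 < Re q"
      using g(2)[OF ball[OF w]] pos by (auto simp: p_def q_def)
    then have "0 < 4 * (Re p * Re q)" by simp
    also have "\<dots> = (cmod (p + cnj q))\<^sup>2 - (cmod (p - q))\<^sup>2"
      unfolding cmod_power2 by (simp add: power2_eq_square algebra_simps)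
    finally have "cmod (p - q) < cmod (p + cnj q)"
      by (simp add: power2_less_imp_less)
    then show ?thesis
      using nz[OF w] by (simp add: u_def p_def q_def norm_divide divide_simps)
  qed
  have hol: "u holomorphic_on ball 0 1"
    unfolding u_def
    by (intro holomorphic_intros holomorphic_on_compose_gen[OF _ g(1), unfolded o_def])
      (use nz ball in auto)
  define w where "w = (z - a) / r"
  have w: "w \<in> ball 0 1" "a + r * w = z" "cmod w = dist a z / r"
    using z r by (auto simp: w_def norm_divide dist_norm norm_minus_commute)
  have "cmod (u w) \<le> cmod w"
    using lt w(1) by (intro Schwarz_Lemma(1)[OF hol]) (auto simp: u_def)
  then have "cmod (g z - g a) \<le> dist a z / r * cmod (g z + cnj (g a))"
    using nz[OF w(1)] by (simp add: u_def w norm_divide pos_divide_le_eq)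
  also have "\<dots> \<le> dist a z / r * (cmod (g z) + cmod (g a))"
    using r norm_triangle_ineq[of "g z" "cnj (g a)"] by (intro mult_left_mono) auto
  finally show ?thesis
    using r by (simp add: field_simps)
qed

text \<open>Cauchy's formula at the centre, applied to \<open>G (z * w)\<close> as a function of
  \<open>w\<close>. The circle starts at \<open>z\<close> rather than at \<open>cmod z\<close>, so
  one rotation parameter \<open>t\<close> serves all \<open>z\<close> and Tonelli's theorem can be
  used on pairs \<open>(t, z)\<close>.\<close>

lemma circle_mean_value:
  assumes "G holomorphic_on ball 0 1" "cmod z < 1"
  shows "((\<lambda>t. G (z * exp (2 * of_real pi * \<i> * of_real t))) has_integral G 0) {0..1}"
proof -
  have sub: "(\<lambda>w. z * w) ` cball 0 1 \<subseteq> ball 0 1"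
  proof clarsimp
    fix w :: complex assume "cmod w \<le> 1"
    then have "cmod z * cmod w \<le> cmod z" by (simp add: mult_left_le)
    then show "cmod (z * w) < 1" using assms by (simp add: norm_mult)
  qed
  have "(\<lambda>w. G (z * w)) holomorphic_on cball 0 1"
    using holomorphic_on_compose_gen[OF _ assms(1) sub, unfolded o_def]
    by (simp add: holomorphic_intros)
  from Cauchy_integral_circlepath_simple[OF this, of 0]
  have "((\<lambda>u. G (z * u) / u) has_contour_integral 2 * of_real pi * \<i> * G 0) (circlepath 0 1)"
    by simp
  then have "((\<lambda>t. G (z * exp (2 * of_real pi * \<i> * of_real t)) * (2 * of_real pi * \<i>))
      has_integral 2 * of_real pi * \<i> * G 0) {0..1}"
    unfolding has_contour_integral_def
    by (rule has_integral_eq[rotated]) (simp add: vector_derivative_circlepath01, simp add: circlepath)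
  from has_integral_mult_right[OF this, of "1 / (2 * of_real pi * \<i>)"]
  show ?thesis by (simp add: field_simps)
qed

text \<open>Kolmogorov's argument: \<open>G = g / (g + c)\<close> has nonnegative real part, at
  least \<open>1 / 4\<close> where \<open>cmod g > c\<close>, while its mean over the circle is
  \<open>G 0\<close>, of modulus at most \<open>cmod (g 0) / c\<close>. Integrating this pointwise
  bound controls \<open>A\<close>.\<close>

lemma circle_weak_type:
  assumes g: "g holomorphic_on ball 0 1" "\<And>z. z \<in> ball 0 1 \<Longrightarrow> 0 < Re (g z)"
    and c: "0 < c" and z: "cmod z < 1"
  defines "A \<equiv> {t \<in> {0..1}. c < cmod (g (z * exp (2 * of_real pi * \<i> * of_real t)))}"
  shows "A \<in> lmeasurable" and "measure lebesgue A \<le> 4 * cmod (g 0) / c"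
proof -
  define e where "e = (\<lambda>t::real. z * exp (2 * of_real pi * \<i> * of_real t))"
  have e: "e t \<in> ball 0 1" for t
    using z by (simp add: e_def norm_mult)
  define G where "G = (\<lambda>w. g w / (g w + of_real c))"
  have nz: "g w + of_real c \<noteq> 0" if "w \<in> ball 0 1" for w
    using g(2)[OF that] c by (auto simp: complex_eq_iff)
  have hol: "G holomorphic_on ball 0 1"
    unfolding G_def using g(1) nz by (intro holomorphic_intros) auto
  have ReG: "Re (G w) = ((cmod (g w))\<^sup>2 + c * Re (g w)) / (cmod (g w + of_real c))\<^sup>2" for w
    unfolding G_def complex_div_cnj[of "g w"] cmod_power2
    by (simp flip: of_real_power add: cmod_power2 power2_eq_square algebra_simps)
  have pos: "0 \<le> Re (G w)" if "w \<in> ball 0 1" for w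
    unfolding ReG using g(2)[OF that] c by simp
  \<comment> \<open>Since \<open>c < cmod (g w)\<close>, the denominator in \<open>ReG\<close> is at
    most twice the numerator; the factor \<open>4\<close> leaves slack.\<close>
  have large: "1 \<le> 4 * Re (G w)" if w: "w \<in> ball 0 1" and "c < cmod (g w)" for w
  proof -
    have "c\<^sup>2 \<le> (cmod (g w))\<^sup>2"
      using that c by (intro power_mono) auto
    moreover have "(cmod (g w + of_real c))\<^sup>2 = (cmod (g w))\<^sup>2 + 2 * (c * Re (g w)) + c\<^sup>2"
      unfolding cmod_power2 by (simp add: power2_eq_square algebra_simps)
    moreover have "0 < c * Re (g w)"
      using g(2)[OF w] c by simp
    ultimately have "(cmod (g w + of_real c))\<^sup>2 \<le> 4 * ((cmod (g w))\<^sup>2 + c * Re (g w))"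
      using zero_le_power2[of "cmod (g w)"] unfolding distrib_left by linarith
    then show ?thesis
      using nz[OF w] by (simp add: ReG divide_simps)
  qed
  have contg: "continuous_on {0..1} (\<lambda>t. cmod (g (e t)))"
    using e by (intro continuous_intros continuous_on_compose2[OF holomorphic_on_imp_continuous_on[OF g(1)]])
      (auto simp: e_def intro!: continuous_intros)
  have "openin (top_of_set {0..1}) A"
    using continuous_openin_preimage_gen[OF contg open_greaterThan[of c]]
    by (simp add: A_def e_def vimage_def Int_def)
  then have "A \<in> sets lebesgue"
    by (rule lebesgue_openin) simp
  moreover have "bounded A"
    by (rule bounded_subset[of "{0..1}"]) (auto simp: A_def)
  ultimately show A: "A \<in> lmeasurable"
    by (simp add: bounded_set_imp_lmeasurable)
  have intG: "((\<lambda>t. 4 * Re (G (e t))) has_integral 4 * Re (G 0)) {0..1}"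
    using has_integral_Re[OF circle_mean_value[OF hol z]]
    by (intro has_integral_mult_right) (simp add: e_def)
  have "(indicator A has_integral measure lebesgue A) {0..1::real}"
  proof -
    have "(\<lambda>t. if t \<in> {0..1} then indicator A t else 0) = (indicator A :: real \<Rightarrow> real)"
      by (auto simp: A_def indicator_def)
    then show ?thesis
      using A has_integral_restrict_UNIV[of "{0..1}" "indicator A :: real \<Rightarrow> real" "measure lebesgue A"]
      by (simp add: lmeasurable_iff_has_integral)
  qed
  then have "measure lebesgue A \<le> 4 * Re (G 0)"
  proof (rule has_integral_le[OF _ intG])
    show "indicator A t \<le> 4 * Re (G (e t))" if "t \<in> {0..1}" for t
      using pos[OF e[of t]] large[OF e[of t]] by (auto simp: indicator_def A_def e_def)
  qed
  also have "Re (G 0) \<le> cmod (g 0) / c"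
  proof -
    have "c \<le> cmod (g 0 + of_real c)"
      using abs_Re_le_cmod[of "g 0 + of_real c"] g(2)[of 0] by simp
    then have "cmod (G 0) \<le> cmod (g 0) / c"
      using c by (simp add: G_def norm_divide frac_le)
    then show ?thesis
      using complex_Re_le_cmod order_trans by blast
  qed
  finally show "measure lebesgue A \<le> 4 * cmod (g 0) / c" by simp
qed

section \<open>Area of superlevel sets in the disc\<close>

lemma open_superlevel:
  fixes g :: "complex \<Rightarrow> complex"
  assumes "g holomorphic_on S" "open S"
  shows "open {z \<in> S. c < cmod (g z)}"
proof -
  have "continuous_on S (\<lambda>z. cmod (g z))"
    using assms(1) by (intro continuous_intros holomorphic_on_imp_continuous_on)
  from continuous_open_preimage[OF this assms(2) open_greaterThan[of c]]
  show ?thesis by (simp add: vimage_def Int_def)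
qed

lemma lmeasurable_superlevel:
  fixes g :: "complex \<Rightarrow> complex"
  assumes "g holomorphic_on S" "open S" "bounded S"
  shows "{z \<in> S. c < cmod (g z)} \<in> lmeasurable"
  using open_superlevel[OF assms(1,2)] bounded_subset[OF assms(3)]
  by (intro lmeasurable_open) auto

text \<open>Tonelli's theorem is used over \<open>lborel\<close>, while the estimates speak of
  \<open>measure lebesgue\<close>; this converts between the two.\<close>

lemma emeasure_lborel_eq_measure_lebesgue:
  assumes "A \<in> lmeasurable" "A \<in> sets borel"
  shows "emeasure lborel A = ennreal (measure lebesgue A)"
proof -
  have "emeasure lborel A = emeasure lebesgue A"
    using assms(2) by simp
  also have "\<dots> = ennreal (measure lebesgue A)"
    using assms(1) by (rule emeasure_eq_measure2)
  finally show ?thesis .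
qed

text \<open>The set \<open>X\<close> of pairs \<open>(t, z)\<close> with \<open>z * e t\<close> in
  \<open>E\<close> is measured in two ways. For fixed \<open>t\<close> the section is a rotated copy
  of \<open>E\<close>; for fixed \<open>z\<close> it obeys the circle estimate and is empty outside
  the annulus \<open>R\<close>. The constant is \<open>25 * 4 * 2 * 2\<close>, from the Lipschitz
  bound for rotations, the circle estimate, the area of \<open>R\<close> and the width
  \<open>\<eta>\<close>.\<close>

lemma disc_weak_type:
  assumes g: "g holomorphic_on ball 0 1" "\<And>z. z \<in> ball 0 1 \<Longrightarrow> 0 < Re (g z)"
    and c: "0 < c"
  shows "measure lebesgue {z \<in> ball 0 1. c < cmod (g z)} \<le> 400 * pi * (cmod (g 0) / c)\<^sup>2"
proof -
  define E where "E = {z \<in> ball 0 1. c < cmod (g z)}"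
  \<comment> \<open>Schwarz-Pick at the centre gives
    \<open>cmod (g z) * (1 - cmod z) \<le> 2 * cmod (g 0)\<close>, so \<open>E\<close> lies within
    this distance of the unit circle.\<close>
  define \<eta> where "\<eta> = 2 * cmod (g 0) / c"
  \<comment> \<open>For \<open>\<eta> > 1\<close> the closed ball has negative radius and is empty,
    so \<open>R\<close> is then the whole disc.\<close>
  define R where "R = ball (0::complex) 1 - cball 0 (1 - \<eta>)"
  define e where "e = (\<lambda>t::real. exp (2 * of_real pi * \<i> * of_real t) :: complex)"
  have norm_e: "cmod (z * e t) = cmod z" for z t
    by (simp add: e_def norm_mult)
  have E: "open E" "E \<subseteq> ball 0 1" "E \<in> lmeasurable"
    using open_superlevel[OF g(1)] lmeasurable_superlevel[OF g(1)] by (auto simp: E_def)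
  have \<eta>: "0 < \<eta>"
  proof -
    have "g 0 \<noteq> 0" using g(2)[of 0] by auto
    then show ?thesis using c by (simp add: \<eta>_def)
  qed
  have ER: "E \<subseteq> R"
  proof
    fix z assume z: "z \<in> E"
    have "cmod (g z) - cmod (g 0) \<le> cmod (g z - g 0)"
      by (rule norm_triangle_ineq2)
    also have "\<dots> \<le> cmod z * (cmod (g z) + cmod (g 0))"
    proof -
      have "z \<in> ball 0 1" using z E(2) by blast
      from Re_pos_Schwarz_Pick[OF g this] show ?thesis by simp
    qed
    finally have "cmod (g z) * (1 - cmod z) \<le> cmod (g 0) * (1 + cmod z)"
      by (simp add: algebra_simps)
    also have "\<dots> \<le> cmod (g 0) * 2"
      using z by (intro mult_left_mono) (auto simp: E_def)
    finally have *: "cmod (g z) * (1 - cmod z) \<le> cmod (g 0) * 2" .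
    have "c * (1 - cmod z) < cmod (g z) * (1 - cmod z)"
      using z by (intro mult_strict_right_mono) (auto simp: E_def)
    with * have "1 - cmod z < \<eta>"
      using c by (simp add: \<eta>_def field_simps)
    then show "z \<in> R"
      using z by (auto simp: R_def E_def)
  qed
  have R: "R \<in> lmeasurable" "measure lebesgue R \<le> 2 * pi * \<eta>"
  proof -
    show "R \<in> lmeasurable"
      unfolding R_def by (intro fmeasurable.Diff) auto
    show "measure lebesgue R \<le> 2 * pi * \<eta>"
    proof (cases "\<eta> \<le> 1")
      case True
      have "measure lebesgue R = measure lebesgue (ball (0::complex) 1) - measure lebesgue (cball (0::complex) (1 - \<eta>))"
        unfolding R_def using \<eta> by (intro measurable_measure_Diff) auto
      also have "\<dots> = pi - pi * (1 - \<eta>)\<^sup>2"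
        using True by (simp add: content_ball content_cball unit_ball_vol_2)
      also have "\<dots> = 2 * pi * \<eta> - pi * \<eta>\<^sup>2"
        by (simp add: power2_eq_square algebra_simps)
      finally show ?thesis by simp
    next
      case False
      have "measure lebesgue R \<le> measure lebesgue (ball (0::complex) 1)"
        by (intro measure_mono_fmeasurable) (auto simp: R_def)
      also have "\<dots> = pi"
        by (simp add: content_ball unit_ball_vol_2)
      also have "\<dots> \<le> 2 * pi * \<eta>"
        using False by simp
      finally show ?thesis .
    qed
  qed
  define X where "X = {(t, z). t \<in> {0..1} \<and> z * e t \<in> E}"
  have X: "X \<in> sets (lborel \<Otimes>\<^sub>M lborel)"
  proof -
    have "X = ({0..1} \<times> UNIV) \<inter> (\<lambda>p. snd p * e (fst p)) -` E"
      by (auto simp: X_def)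
    moreover have "open ((\<lambda>p. snd p * e (fst p)) -` E)"
      by (intro open_vimage[OF E(1)]) (auto simp: e_def intro!: continuous_intros)
    ultimately have "X \<in> sets borel"
      by (simp only:) (intro sets.Int borel_closed[OF closed_Times] borel_open; simp)
    moreover have "sets (lborel \<Otimes>\<^sub>M lborel) = sets (borel \<Otimes>\<^sub>M borel :: (real \<times> complex) measure)"
      by (intro sets_pair_measure_cong sets_lborel)
    ultimately show ?thesis by (simp only: borel_prod)
  qed
  have "ennreal (measure lebesgue E / 25) = (\<integral>\<^sup>+t. ennreal (measure lebesgue E / 25) * indicator {0..1::real} t \<partial>lborel)"
    by (simp add: nn_integral_cmult)
  also have "\<dots> \<le> (\<integral>\<^sup>+t. emeasure lborel (Pair t -` X) \<partial>lborel)"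
  proof (intro nn_integral_mono)
    fix t :: real
    show "ennreal (measure lebesgue E / 25) * indicator {0..1} t \<le> emeasure lborel (Pair t -` X)"
    proof (cases "t \<in> {0..1}")
      case True
      define S where "S = (\<lambda>z. z * e t) -` E"
      have S: "open S" "S \<subseteq> ball 0 1" "S \<in> lmeasurable"
      proof -
        show "open S"
          unfolding S_def by (intro open_vimage[OF E(1)] continuous_intros)
        show "S \<subseteq> ball 0 1"
          using E(2) norm_e by (auto simp: S_def)
        with \<open>open S\<close> show "S \<in> lmeasurable"
          by (intro lmeasurable_open bounded_subset[OF bounded_ball])
      qed
      have "E \<subseteq> (\<lambda>z. z * e t) ` S"
      proof
        fix z assume "z \<in> E"
        then show "z \<in> (\<lambda>z. z * e t) ` S"
          by (intro image_eqI[of _ _ "z / e t"]) (auto simp: S_def e_def)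
      qed
      \<comment> \<open>The rotation has Lipschitz constant \<open>1\<close>; in real dimension two
        the covering bound costs the factor \<open>25\<close>.\<close>
      then have "measure lebesgue E \<le> (5 * 1) ^ DIM(complex) * measure lebesgue S"
        using S E norm_e
        by (intro measure_lipschitz_image_le[where f = "\<lambda>z. z * e t"])
          (auto simp: dist_norm simp flip: left_diff_distrib)
      then have "ennreal (measure lebesgue E / 25) \<le> ennreal (measure lebesgue S)"
        by (intro ennreal_leI) simp
      also have "\<dots> = emeasure lborel S"
        using S by (simp add: emeasure_lborel_eq_measure_lebesgue del: measure_completion)
      also have "S = Pair t -` X"
        using True by (auto simp: S_def X_def)
      finally show ?thesis
        using True by simp
    qed simp
  qed
  also have "\<dots> = emeasure (lborel \<Otimes>\<^sub>M lborel) X"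
    using X by (simp add: lborel.emeasure_pair_measure_alt)
  also have "\<dots> = (\<integral>\<^sup>+z. emeasure lborel ((\<lambda>t. (t, z)) -` X) \<partial>lborel)"
    using X by (rule lborel_pair.emeasure_pair_measure_alt2)
  also have "\<dots> \<le> (\<integral>\<^sup>+z. ennreal (4 * cmod (g 0) / c) * indicator R z \<partial>lborel)"
  proof (intro nn_integral_mono)
    fix z :: complex
    show "emeasure lborel ((\<lambda>t. (t, z)) -` X) \<le> ennreal (4 * cmod (g 0) / c) * indicator R z"
    proof (cases "z \<in> R")
      case True
      then have z: "cmod z < 1" by (auto simp: R_def)
      define A where "A = {t \<in> {0..1}. c < cmod (g (z * exp (2 * of_real pi * \<i> * of_real t)))}"
      have A: "A \<in> lmeasurable" "measure lebesgue A \<le> 4 * cmod (g 0) / c"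
        unfolding A_def using circle_weak_type[OF g c z] by blast+
      have eq: "(\<lambda>t. (t, z)) -` X = A"
        using z norm_e[of z] by (auto simp: X_def A_def E_def e_def)
      have "(\<lambda>t. (t, z)) -` X \<in> sets lborel"
        using X by (rule sets_Pair2)
      then have "emeasure lborel A = ennreal (measure lebesgue A)"
        unfolding eq using A(1) by (intro emeasure_lborel_eq_measure_lebesgue) simp_all
      then show ?thesis
        unfolding eq using A(2) True by (simp add: ennreal_leI)
    next
      case False
      \<comment> \<open>Rotations preserve \<open>cmod\<close>, hence \<open>R\<close>, so a point
        outside \<open>R\<close> is never rotated into \<open>E\<close>.\<close>
      then have "(\<lambda>t. (t, z)) -` X = {}"
        using ER norm_e[of z] by (auto simp: X_def R_def subset_iff)
      then show ?thesis by simp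
    qed
  qed
  also have "\<dots> = ennreal (4 * cmod (g 0) / c) * emeasure lborel R"
    by (rule nn_integral_cmult_indicator) (simp add: R_def)
  also have "emeasure lborel R = ennreal (measure lebesgue R)"
    using R(1) by (intro emeasure_lborel_eq_measure_lebesgue) (simp_all add: R_def)
  finally have "measure lebesgue E / 25 \<le> 4 * cmod (g 0) / c * measure lebesgue R"
    using c by (simp flip: ennreal_mult)
  also have "\<dots> \<le> 4 * cmod (g 0) / c * (2 * pi * \<eta>)"
    using R(2) c by (intro mult_left_mono) auto
  also have "\<dots> = 16 * pi * (cmod (g 0) / c)\<^sup>2"
    by (simp add: \<eta>_def power2_eq_square)
  finally show ?thesis
    by (simp add: E_def)
qed

section \<open>Transport to the boundary by a Moebius map\<close>

text \<open>Precomposing \<open>f\<close> with the automorphism \<open>\<psi>\<close> that sends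
  \<open>0\<close> to \<open>a\<close> reduces the claim to the weak type estimate on the whole
  disc, now with value \<open>f a\<close> at the centre. On the disc \<open>\<psi>\<close> may
  expand, but where its image stays within \<open>6 * d\<close> of \<open>a\<close> it is Lipschitz
  with constant \<open>64 * d\<close>, which yields the factor
  \<open>(5 * 64 * d)\<^sup>2\<close>.\<close>

lemma Carleson_box_weak_type:
  assumes f: "f holomorphic_on ball 0 1" "\<And>z. z \<in> ball 0 1 \<Longrightarrow> 0 < Re (f z)"
    and a: "a \<in> ball 0 1" and c: "0 < c"
  defines "d \<equiv> 1 - cmod a"
  shows "measure lebesgue {z \<in> ball 0 1 \<inter> ball a (6 * d). c < cmod (f z)}
    \<le> (320 * d)\<^sup>2 * (400 * pi * (cmod (f a) / c)\<^sup>2)"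
proof -
  have d: "0 < d" "d \<le> 1" "cmod a < 1"
    using a by (auto simp: d_def)
  \<comment> \<open>\<open>\<phi>\<close> sends \<open>w\<close> to
    \<open>(w - a) / (1 - cnj a * w)\<close>, and \<open>\<psi>\<close> is its inverse on the
    disc.\<close>
  define \<phi> \<psi> where "\<phi> = Moebius_function 0 a" and "\<psi> = Moebius_function 0 (- a)"
  have \<phi>\<psi>: "\<phi> (\<psi> w) = w" and \<psi>\<phi>: "\<psi> (\<phi> w) = w" if "w \<in> ball 0 1" for w
    using that d Moebius_function_compose[of "- a" a w] Moebius_function_compose[of a "- a" w]
    by (auto simp: \<phi>_def \<psi>_def)
  have ball: "\<phi> w \<in> ball 0 1" "\<psi> w \<in> ball 0 1" if "w \<in> ball 0 1" for w
    using that d by (auto simp: \<phi>_def \<psi>_def Moebius_function_norm_lt_1)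
  have hol: "\<psi> holomorphic_on ball 0 1"
    unfolding \<psi>_def using d by (intro Moebius_function_holomorphic) auto
  have holg: "(\<lambda>w. f (\<psi> w)) holomorphic_on ball 0 1"
    using holomorphic_on_compose_gen[OF hol f(1) image_subsetI[OF ball(2)]] by (simp add: o_def)
  have \<psi>0: "\<psi> 0 = a"
    by (simp add: \<psi>_def Moebius_function_def)
  define S where "S = {w \<in> ball 0 1. c < cmod (f (\<psi> w))} \<inter> {w \<in> ball 0 1. \<psi> w \<in> ball a (6 * d)}"
  have S: "open S" "S \<in> lmeasurable"
  proof -
    have "open (ball 0 1 \<inter> \<psi> -` ball a (6 * d))"
      by (intro continuous_open_preimage holomorphic_on_imp_continuous_on hol) auto
    then show "open S"
      unfolding S_def using open_superlevel[OF holg] by (intro open_Int) (auto simp: vimage_def Int_def)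
    then show "S \<in> lmeasurable"
      by (intro lmeasurable_open bounded_subset[OF bounded_ball[of 0 1]]) (auto simp: S_def)
  qed
  define T where "T = {z \<in> ball 0 1 \<inter> ball a (6 * d). c < cmod (f z)}"
  have T: "T \<subseteq> \<psi> ` S"
  proof
    fix z assume "z \<in> T"
    then show "z \<in> \<psi> ` S"
      using ball[of z] \<psi>\<phi>[of z] by (intro image_eqI[of _ _ "\<phi> z"]) (auto simp: T_def S_def)
  qed
  have "T \<in> lmeasurable"
    unfolding T_def by (intro lmeasurable_superlevel holomorphic_on_subset[OF f(1)]) auto
  then have T_sets: "T \<in> sets lebesgue"
    by (rule fmeasurableD)
  have lip: "dist (\<psi> v) (\<psi> w) \<le> 64 * d * dist v w" if "v \<in> S" "w \<in> S" for v w
  proof -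
    define x y where "x = \<psi> v" and "y = \<psi> w"
    have xy: "x \<in> ball 0 1" "y \<in> ball 0 1" "x \<in> ball a (6 * d)" "y \<in> ball a (6 * d)" "v = \<phi> x" "w = \<phi> y"
      using that ball \<phi>\<psi> by (auto simp: S_def x_def y_def)
    have sq: "(of_real (cmod a))\<^sup>2 = a * cnj a"
      using complex_norm_square[of a] by simp
    \<comment> \<open>Near \<open>a\<close> these denominators of \<open>\<phi>\<close> are of order
      \<open>d\<close>, so \<open>\<phi>\<close> stretches by at least order \<open>1 / d\<close>
      there; this is the contraction of \<open>\<psi>\<close>.\<close>
    have den: "cmod (1 - cnj a * u) \<le> 8 * d" if "u \<in> ball a (6 * d)" for u
    proof -
      have "1 - cnj a * u = of_real (1 - (cmod a)\<^sup>2) + cnj a * (a - u)"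
        by (simp add: algebra_simps sq)
      then have "cmod (1 - cnj a * u) \<le> cmod (of_real (1 - (cmod a)\<^sup>2)) + cmod (cnj a * (a - u))"
        by (metis norm_triangle_ineq)
      also have "\<dots> = (1 - (cmod a)\<^sup>2) + cmod a * cmod (a - u)"
        using d by (simp add: norm_mult power_le_one del: of_real_diff)
      also have "1 - (cmod a)\<^sup>2 = (1 + cmod a) * d"
        by (simp add: d_def power2_eq_square algebra_simps)
      also have "\<dots> \<le> 2 * d"
        using d by (intro mult_right_mono) auto
      also have "cmod a * cmod (a - u) \<le> 1 * (6 * d)"
        using that d by (intro mult_mono) (auto simp: dist_norm)
      finally show ?thesis by simp
    qed
    have nz: "1 - cnj a * u \<noteq> 0" if "u \<in> ball 0 1" for u
    proof -
      have "cmod a * cmod u \<le> cmod a"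
        using that by (simp add: mult_left_le)
      then have "cmod (cnj a * u) < cmod 1"
        using d by (simp add: norm_mult)
      then show ?thesis by force
    qed
    \<comment> \<open>The difference \<open>\<phi> x - \<phi> y\<close> in closed form, multiplied
      out. Bounding the two denominators by \<open>8 * d\<close> and
      \<open>1 - (cmod a)\<^sup>2\<close> below by \<open>d\<close> leaves the constant
      \<open>64 * d\<close>.\<close>
    have "(v - w) * ((1 - cnj a * x) * (1 - cnj a * y)) = (x - a) * (1 - cnj a * y) - (y - a) * (1 - cnj a * x)"
    proof -
      have "(X / p - Y / q) * (p * q) = X * q - Y * p" if "p \<noteq> 0" "q \<noteq> 0" for X Y p q :: complex
        using that by (simp add: field_simps)
      from this[OF nz[OF xy(1)] nz[OF xy(2)]] show ?thesis
        unfolding xy(5,6) \<phi>_def Moebius_function_simple .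
    qed
    also have "\<dots> = (x - y) * of_real (1 - (cmod a)\<^sup>2)"
      by (simp add: sq algebra_simps)
    finally have prod_eq: "(v - w) * ((1 - cnj a * x) * (1 - cnj a * y)) = (x - y) * of_real (1 - (cmod a)\<^sup>2)" .
    have "cmod (of_real (1 - (cmod a)\<^sup>2)) = 1 - (cmod a)\<^sup>2"
      using d by (simp add: power_le_one del: of_real_diff)
    then have "cmod (v - w) * (cmod (1 - cnj a * x) * cmod (1 - cnj a * y)) = cmod (x - y) * (1 - (cmod a)\<^sup>2)"
      using arg_cong[OF prod_eq, of cmod] by (simp only: norm_mult)
    moreover have "d \<le> 1 - (cmod a)\<^sup>2"
      using d by (simp add: d_def power2_eq_square mult_left_le)
    ultimately have "cmod (x - y) * d \<le> cmod (v - w) * (cmod (1 - cnj a * x) * cmod (1 - cnj a * y))"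
      by (simp add: mult_left_mono)
    also have "\<dots> \<le> cmod (v - w) * ((8 * d) * (8 * d))"
      using den xy d by (intro mult_left_mono mult_mono) auto
    finally have "d * cmod (x - y) \<le> d * (64 * d * cmod (v - w))"
      by (simp add: mult_ac)
    then show ?thesis
      using d by (simp add: dist_norm x_def y_def)
  qed
  have "measure lebesgue T \<le> (5 * (64 * d)) ^ DIM(complex) * measure lebesgue S"
    using d by (intro measure_lipschitz_image_le[OF S T_sets T] lip) auto
  also have "\<dots> = (320 * d)\<^sup>2 * measure lebesgue S"
    by simp
  also have "\<dots> \<le> (320 * d)\<^sup>2 * (400 * pi * (cmod (f a) / c)\<^sup>2)"
  proof (rule mult_left_mono)
    have "measure lebesgue S \<le> measure lebesgue {w \<in> ball 0 1. c < cmod (f (\<psi> w))}"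
      using fmeasurableD[OF S(2)] lmeasurable_superlevel[OF holg]
      by (intro measure_mono_fmeasurable) (auto simp: S_def)
    also have "\<dots> \<le> 400 * pi * (cmod (f (\<psi> 0)) / c)\<^sup>2"
      by (rule disc_weak_type[OF holg f(2)[OF ball(2)] c])
    finally show "measure lebesgue S \<le> 400 * pi * (cmod (f a) / c)\<^sup>2"
      by (simp add: \<psi>0)
  qed simp
  finally show ?thesis
    by (simp add: T_def)
qed

section \<open>Quadratic decay of superlevel sets\<close>

text \<open>The constant is \<open>320\<^sup>2 * 400 * 4\<^sup>2\<close> from the local estimate at \<open>cmod (f a) = 4\<close>, times \<open>4\<close> because
the disjoint discs have radius \<open>(1 - cmod a) / 2\<close>.\<close>

lemma superlevel_measure_decay:
  assumes f: "f holomorphic_on ball 0 1" "\<And>z. z \<in> ball 0 1 \<Longrightarrow> 0 < Re (f z)"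
    and f0: "cmod (f 0) \<le> 1" and c: "1 \<le> c"
  shows "measure lebesgue {z \<in> ball 0 1. c < cmod (f z)}
    \<le> 2621440000 / c\<^sup>2 * measure lebesgue {z \<in> ball 0 1. 1 < cmod (f z)}"
proof -
  define E where "E = (\<lambda>c. {z \<in> ball 0 1. c < cmod (f z)})"
  have E: "E c \<in> lmeasurable" for c
    unfolding E_def by (intro lmeasurable_superlevel f) auto
  have "measure lebesgue (E c) \<le> 2621440000 / c\<^sup>2 * measure lebesgue (E 1)"
  proof (cases "c \<le> 4")
    case True
    \<comment> \<open>For bounded \<open>c\<close> the factor in front exceeds \<open>1\<close> and
      monotonicity suffices.\<close>
    have "c\<^sup>2 \<le> 4\<^sup>2"
      using True c by (intro power_mono) auto
    then have "1 \<le> 2621440000 / c\<^sup>2"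
      using c by (simp add: divide_simps)
    moreover have "measure lebesgue (E c) \<le> measure lebesgue (E 1)"
      using E c by (intro measure_mono_fmeasurable) (auto simp: E_def fmeasurableD)
    ultimately show ?thesis
      using mult_mono[of 1 "2621440000 / c\<^sup>2" "measure lebesgue (E c)" "measure lebesgue (E 1)"] by simp
  next
    case False
    \<comment> \<open>The intermediate value theorem on the segment from \<open>0\<close>, where
      \<open>cmod f \<le> 1\<close>, to \<open>z\<close>, where \<open>cmod f > c > 4\<close>. A
      point \<open>a = t * z\<close> has distance \<open>(1 - t) * cmod z \<le> 1 - cmod a\<close>
      from \<open>z\<close>.\<close>
    have "\<exists>a \<in> ball 0 1. cmod (f a) = 4 \<and> dist a z \<le> 1 - cmod a" if z: "z \<in> E c" for z
    proof -
      have zt: "of_real t * z \<in> ball 0 1" if "t \<in> {0..1}" for t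
      proof -
        have "t * cmod z \<le> 1 * cmod z"
          using that by (intro mult_right_mono) auto
        then show ?thesis
          using that z by (auto simp: E_def norm_mult)
      qed
      have "continuous_on {0..1} (\<lambda>t. cmod (f (of_real t * z)))"
        using zt by (intro continuous_intros continuous_on_compose2[OF holomorphic_on_imp_continuous_on[OF f(1)]]) auto
      moreover have "cmod (f (of_real 0 * z)) \<le> 4" "4 \<le> cmod (f (of_real 1 * z))"
        using f0 z False by (auto simp: E_def)
      ultimately obtain t where t: "0 \<le> t" "t \<le> 1" "cmod (f (of_real t * z)) = 4"
        using IVT'[of "\<lambda>t. cmod (f (of_real t * z))" 0 4 1] by auto
      have "dist (of_real t * z) z = cmod (of_real (1 - t) * z)"
        by (simp add: dist_norm norm_minus_commute algebra_simps)
      also have "\<dots> = (1 - t) * cmod z"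
        using t by (simp add: norm_mult del: of_real_diff)
      also have "\<dots> \<le> 1 - cmod (of_real t * z)"
        using t z by (simp add: norm_mult E_def algebra_simps)
      finally show ?thesis
        using t zt[of t] by auto
    qed
    then obtain a where a: "\<And>z. z \<in> E c \<Longrightarrow> a z \<in> ball 0 1" "\<And>z. z \<in> E c \<Longrightarrow> cmod (f (a z)) = 4"
        "\<And>z. z \<in> E c \<Longrightarrow> dist (a z) z \<le> 1 - cmod (a z)"
      by metis
    define r where "r = (\<lambda>z. 1 - cmod (a z))"
    have r: "0 < r z" "r z \<le> 1" if "z \<in> E c" for z
      using a(1)[OF that] by (auto simp: r_def)
    have "E c \<subseteq> (\<Union>z\<in>E c. cball (a z) (r z))"
      using a(3) by (auto simp: r_def)
    then obtain C where C: "countable C" "C \<subseteq> E c"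
        "pairwise (\<lambda>x y. disjnt (cball (a x) (r x)) (cball (a y) (r y))) C"
        "E c \<subseteq> (\<Union>z\<in>C. cball (a z) (5 * r z))"
      using Vitali_covering_lemma_cballs[of "E c" a r "E c" 1] r by auto
    \<comment> \<open>Radius \<open>6 * r z\<close> makes the open ball contain the closed fivefold
      ball of the covering. The discs \<open>D z\<close> have half the radius of the selected balls,
      so that Schwarz-Pick on the full ball keeps \<open>cmod f\<close> comparable to its value
      \<open>4\<close> at the centre.\<close>
    define B where "B = (\<lambda>z. {w \<in> ball 0 1 \<inter> ball (a z) (6 * r z). c < cmod (f w)})"
    define D where "D = (\<lambda>z. ball (a z) (r z / 2))"
    show ?thesis
    proof (rule measure_le_disjoint_packing[of C "E c" B D "E 1"])
      show "E c \<subseteq> (\<Union>z\<in>C. B z)"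
      proof
        fix w assume w: "w \<in> E c"
        then obtain z where z: "z \<in> C" "w \<in> cball (a z) (5 * r z)"
          using C(4) by auto
        then have "w \<in> ball (a z) (6 * r z)"
          using r(1)[of z] C(2) by auto
        then show "w \<in> (\<Union>z\<in>C. B z)"
          using z w by (auto simp: B_def E_def)
      qed
      show "B z \<in> lmeasurable" for z
      proof -
        have "B z = E c \<inter> ball (a z) (6 * r z)"
          by (auto simp: B_def E_def)
        then show ?thesis
          using E by (auto intro!: fmeasurable_Int_fmeasurable)
      qed
      show "pairwise (\<lambda>x y. disjnt (D x) (D y)) C"
      proof (rule pairwiseI)
        fix x y assume xy: "x \<in> C" "y \<in> C" "x \<noteq> y"
        have "D z \<subseteq> cball (a z) (r z)" if "z \<in> C" for z
          using r(1)[of z] that C(2) by (auto simp: D_def)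
        then show "disjnt (D x) (D y)"
          using xy pairwiseD[OF C(3) xy] by (meson disjnt_subset1 disjnt_subset2)
      qed
      fix z assume z: "z \<in> C"
      then have zE: "z \<in> E c" using C by auto
      show "D z \<subseteq> E 1"
      proof
        fix w assume w: "w \<in> D z"
        have sub: "ball (a z) (r z) \<subseteq> ball 0 1"
        proof
          fix u assume "u \<in> ball (a z) (r z)"
          then show "u \<in> ball 0 1"
            using norm_triangle_sub[of u "a z"] by (simp add: r_def dist_norm norm_minus_commute)
        qed
        have w': "w \<in> ball (a z) (r z)" "dist (a z) w < r z / 2"
          using w r(1)[OF zE] by (auto simp: D_def)
        have "4 - cmod (f w) \<le> cmod (f w - f (a z))"
          using norm_triangle_ineq3[of "f w" "f (a z)"] a(2)[OF zE] by linarith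
        then have "r z * (4 - cmod (f w)) \<le> r z * cmod (f w - f (a z))"
          using r(1)[OF zE] by (intro mult_left_mono) auto
        also have "\<dots> \<le> dist (a z) w * (cmod (f w) + cmod (f (a z)))"
          using sub w'(1) f by (intro Re_pos_Schwarz_Pick) (auto intro: holomorphic_on_subset)
        also have "\<dots> \<le> r z / 2 * (cmod (f w) + cmod (f (a z)))"
          using w'(2) by (intro mult_right_mono) auto
        finally have "r z * (4 - cmod (f w)) \<le> r z * ((cmod (f w) + 4) / 2)"
          using a(2)[OF zE] by simp
        \<comment> \<open>This amounts to \<open>cmod (f w) \<ge> 4 / 3\<close>: level
          \<open>4\<close> at the centre is high enough to stay above \<open>1\<close> on the half
          disc.\<close>
        then have "4 - cmod (f w) \<le> (cmod (f w) + 4) / 2"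
          using r(1)[OF zE] by simp
        then show "w \<in> E 1"
          using w'(1) sub by (auto simp: E_def)
      qed
      have "measure lebesgue (B z) \<le> (320 * r z)\<^sup>2 * (400 * pi * (cmod (f (a z)) / c)\<^sup>2)"
        unfolding B_def r_def using c by (intro Carleson_box_weak_type f a(1) zE) auto
      also have "\<dots> = 2621440000 / c\<^sup>2 * (pi * (r z / 2)\<^sup>2)"
        using a(2)[OF zE] by (simp add: power_divide power_mult_distrib)
      also have "pi * (r z / 2)\<^sup>2 = measure lebesgue (D z)"
        using r(1)[OF zE] by (simp add: D_def content_ball unit_ball_vol_2)
      finally show "measure lebesgue (B z) \<le> 2621440000 / c\<^sup>2 * measure lebesgue (D z)" .
    qed (use C E in \<open>auto simp: D_def fmeasurableD\<close>)
  qed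
  then show ?thesis by (simp add: E_def)
qed

section \<open>From Carleson windows to superlevel sets\<close>

theorem theorem3p1:
  shows "\<exists>C0 > 0. \<forall>\<phi> :: complex \<Rightarrow> complex.
           \<phi> holomorphic_on unit_disc \<and> \<phi> ` unit_disc \<subseteq> unit_disc \<longrightarrow>
           (\<forall>\<xi> h \<epsilon>. cmod \<xi> = 1 \<and> 0 < h \<and> h < 1 - cmod (\<phi> 0) \<and> 0 < \<epsilon> \<and> \<epsilon> \<le> 1 \<longrightarrow>
              nArea {z \<in> unit_disc. \<phi> z \<in> carleson_window \<xi> (\<epsilon> * h)}
                \<le> C0 * \<epsilon>\<^sup>2 * nArea {z \<in> unit_disc. \<phi> z \<in> carleson_window \<xi> h})"
proof (intro exI[of _ "2621440000::real"] conjI allI impI; (elim conjE)?)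
  fix \<phi> :: "complex \<Rightarrow> complex" and \<xi> :: complex and h \<epsilon> :: real
  assume hol: "\<phi> holomorphic_on unit_disc" and maps: "\<phi> ` unit_disc \<subseteq> unit_disc"
    and \<xi>: "cmod \<xi> = 1" and h: "0 < h" "h < 1 - cmod (\<phi> 0)" and \<epsilon>: "0 < \<epsilon>" "\<epsilon> \<le> 1"
  define f where "f = (\<lambda>z. of_real h / (1 - cnj \<xi> * \<phi> z))"
  have \<phi>: "cmod (\<phi> z) < 1" if "z \<in> ball 0 1" for z
    using subsetD[OF maps imageI[of z unit_disc \<phi>]] that by (simp add: unit_disc_def)
  have pos: "0 < Re (1 - cnj \<xi> * \<phi> z)" if "z \<in> ball 0 1" for z
    using complex_Re_le_cmod[of "cnj \<xi> * \<phi> z"] \<phi>[OF that] \<xi> by (simp add: norm_mult)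
  have Re_f: "0 < Re (f z)" if "z \<in> ball 0 1" for z
    using pos[OF that] h by (simp add: f_def Re_divide sum_power2_gt_zero_iff)
  have hol_f: "f holomorphic_on ball 0 1"
    unfolding f_def
  proof (intro holomorphic_intros)
    show "\<phi> holomorphic_on ball 0 1"
      using hol by (simp add: unit_disc_def)
    show "1 - cnj \<xi> * \<phi> z \<noteq> 0" if "z \<in> ball 0 1" for z
      using pos[OF that] by (metis less_irrefl zero_complex.simps(1))
  qed
  have dist_f: "cmod (1 - cnj \<xi> * \<phi> z) = cmod (\<phi> z - \<xi>)" for z
  proof -
    have "cnj \<xi> * \<xi> = 1"
      using \<xi> by (simp add: complex_norm_square[symmetric] mult.commute)
    then have "1 - cnj \<xi> * \<phi> z = cnj \<xi> * (\<xi> - \<phi> z)"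
      by (simp add: algebra_simps)
    then show ?thesis
      using \<xi> by (simp add: norm_mult norm_minus_commute)
  qed
  have window: "{z \<in> unit_disc. \<phi> z \<in> carleson_window \<xi> (s * h)} = {z \<in> ball 0 1. 1 / s < cmod (f z)}"
    if "0 < s" for s
  proof -
    have "cmod (\<phi> z - \<xi>) < s * h \<longleftrightarrow> 1 / s < cmod (f z)" if "z \<in> ball 0 1" for z
    proof -
      \<comment> \<open>Strict positivity, from \<open>\<phi> z\<close> in the open disc and
        \<open>\<xi>\<close> on the circle, allows the inequality to be inverted.\<close>
      have "0 < cmod (\<phi> z - \<xi>)"
        using \<phi>[OF that] \<xi> by auto
      then show ?thesis
        using \<open>0 < s\<close> h by (simp add: f_def norm_divide dist_f field_simps)
    qed
    then show ?thesis
      using \<phi> by (auto simp: carleson_window_def unit_disc_def)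
  qed
  \<comment> \<open>The restriction \<open>h < 1 - cmod (\<phi> 0)\<close> keeps
    \<open>\<phi> 0\<close> outside the window of size \<open>h\<close>; this is the normalization
    \<open>cmod (f 0) \<le> 1\<close> of the decay estimate, used with
    \<open>c = 1 / \<epsilon>\<close>.\<close>
  have "h \<le> cmod (\<phi> 0 - \<xi>)"
    using h norm_triangle_ineq2[of \<xi> "\<phi> 0"] \<xi> by (simp add: norm_minus_commute)
  then have "cmod (f 0) \<le> 1"
    using h by (simp add: f_def norm_divide dist_f divide_le_eq_1)
  then have "measure lebesgue {z \<in> ball 0 1. 1 / \<epsilon> < cmod (f z)}
      \<le> 2621440000 / (1 / \<epsilon>)\<^sup>2 * measure lebesgue {z \<in> ball 0 1. 1 < cmod (f z)}"
    using \<epsilon> by (intro superlevel_measure_decay hol_f Re_f) auto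
  then show "nArea {z \<in> unit_disc. \<phi> z \<in> carleson_window \<xi> (\<epsilon> * h)}
      \<le> 2621440000 * \<epsilon>\<^sup>2 * nArea {z \<in> unit_disc. \<phi> z \<in> carleson_window \<xi> h}"
    using window[OF \<epsilon>(1)] window[of 1]
    by (simp add: nArea_def divide_right_mono power_divide)
qed simp

end
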